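(* Let $k\ge0$ be an integer and $I$ any imaginary unit. For every $t\in\mathbb R$ and $q\in\mathbb H$, the kernel $$B_{2,k}(t;q)=\sum_{j=0}^{+\infty}\frac{h_j(t)\,\overline{H^Q_{j,k}(q,\overline q)}}{\|h_j\|_{\mathbb R}\,\|H^Q_{j,k}\|_{\mathbb C_I}}$$ is given by $$B_{2,k}(t;q)=\Big(\frac1\pi\Big)^{3/4}\frac1{\sqrt{2^kk!}}\exp\Big(-\frac{t^2+\overline q^{\,2}}2+\sqrt2\,\overline q\,t\Big)H_k\Big(\frac{q+\overline q}{\sqrt2}-t\Big).$$ Moreover, for every fixed $q\in\mathbb H$ the function $B_{2,k;q}:t\mapsto B_{2,k}(t;q)$ belongs to $L^2_{\mathbb H}(\mathbb R;dt)$, and $$\|B_{2,k;q}\|_{\mathbb R}=\frac1{\sqrt\pi}\,e^{|q|^2/2}.$$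
   Context: $\mathbb H$ is the algebra of quaternions; an imaginary unit is $I\in\mathbb H$ with $I^2=-1$; $\mathbb C_I=\mathbb R+\mathbb R I$, with Lebesgue measure $d\lambda_I$. $L^2_{\mathbb H}(\mathbb R;dt)$ is the space of $\mathbb H$-valued square integrable functions on $\mathbb R$ with $\langle f,g\rangle_{\mathbb R}=\int_{\mathbb R}\overline{f(t)}g(t)\,dt$ and norm $\|\cdot\|_{\mathbb R}$. $H_j$ is the real (physicists') Hermite polynomial, and $h_j(t)=(-1)^je^{t^2/2}\frac{d^j}{dt^j}(e^{-t^2})=e^{-t^2/2}H_j(t)$, with $\|h_j\|_{\mathbb R}^2=2^jj!\sqrt\pi$. Quaternionic Hermite polynomials: $H^Q_{m,n}(q,\overline q)=m!n!\sum_{j=0}^{\min(m,n)}\frac{(-1)^j}{j!}\frac{q^{m-j}\overline q^{\,n-j}}{(m-j)!(n-j)!}$. The norm $\|f\|_{\mathbb C_I}$ is given by $\|f\|_{\mathbb C_I}^2=\int_{\mathbb C_I}|f(q)|^2e^{-|q|^2}d\lambda_I(q)$, and $\|H^Q_{j,k}\|^2_{\mathbb C_I}=\pi j!k!$ (independent of $I$). *)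

theory Defs
  imports "HOL-Analysis.Analysis" "HOL-Computational_Algebra.Polynomial"
begin

section \<open>Quaternions\<close>

codatatype quat = Quat (qRe: real) (qIm1: real) (qIm2: real) (qIm3: real)

lemma quat_eq_iff:
  "x = y \<longleftrightarrow> qRe x = qRe y \<and> qIm1 x = qIm1 y \<and> qIm2 x = qIm2 y \<and> qIm3 x = qIm3 y"
  by (auto intro: quat.expand)

instantiation quat :: ab_group_add
begin

primcorec zero_quat where
  "qRe 0 = 0" | "qIm1 0 = 0" | "qIm2 0 = 0" | "qIm3 0 = 0"

primcorec plus_quat where
  "qRe (x + y) = qRe x + qRe y"
| "qIm1 (x + y) = qIm1 x + qIm1 y"
| "qIm2 (x + y) = qIm2 x + qIm2 y"
| "qIm3 (x + y) = qIm3 x + qIm3 y"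

primcorec uminus_quat where
  "qRe (- x) = - qRe x"
| "qIm1 (- x) = - qIm1 x"
| "qIm2 (- x) = - qIm2 x"
| "qIm3 (- x) = - qIm3 x"

primcorec minus_quat where
  "qRe (x - y) = qRe x - qRe y"
| "qIm1 (x - y) = qIm1 x - qIm1 y"
| "qIm2 (x - y) = qIm2 x - qIm2 y"
| "qIm3 (x - y) = qIm3 x - qIm3 y"

instance
  by standard (simp_all add: quat_eq_iff)

end

instantiation quat :: ring_1
begin

primcorec one_quat where
  "qRe 1 = 1" | "qIm1 1 = 0" | "qIm2 1 = 0" | "qIm3 1 = 0"

primcorec times_quat where
  "qRe (x * y) = qRe x * qRe y - qIm1 x * qIm1 y - qIm2 x * qIm2 y - qIm3 x * qIm3 y"
| "qIm1 (x * y) = qRe x * qIm1 y + qIm1 x * qRe y + qIm2 x * qIm3 y - qIm3 x * qIm2 y"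
| "qIm2 (x * y) = qRe x * qIm2 y - qIm1 x * qIm3 y + qIm2 x * qRe y + qIm3 x * qIm1 y"
| "qIm3 (x * y) = qRe x * qIm3 y + qIm1 x * qIm2 y - qIm2 x * qIm1 y + qIm3 x * qRe y"

instance
  by standard (simp_all add: quat_eq_iff algebra_simps)

end

instantiation quat :: real_algebra_1
begin

primcorec scaleR_quat where
  "qRe (scaleR r x) = r * qRe x"
| "qIm1 (scaleR r x) = r * qIm1 x"
| "qIm2 (scaleR r x) = r * qIm2 x"
| "qIm3 (scaleR r x) = r * qIm3 x"

instance
  by standard (simp_all add: quat_eq_iff algebra_simps)

end

primcorec qcnj :: "quat \<Rightarrow> quat" where
  "qRe (qcnj x) = qRe x"
| "qIm1 (qcnj x) = - qIm1 x"
| "qIm2 (qcnj x) = - qIm2 x"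
| "qIm3 (qcnj x) = - qIm3 x"

instantiation quat :: real_inner
begin

definition inner_quat :: "quat \<Rightarrow> quat \<Rightarrow> real" where
  "inner_quat x y = qRe x * qRe y + qIm1 x * qIm1 y + qIm2 x * qIm2 y + qIm3 x * qIm3 y"

definition norm_quat :: "quat \<Rightarrow> real" where
  "norm_quat x = sqrt (inner x x)"

definition sgn_quat :: "quat \<Rightarrow> quat" where
  "sgn_quat x = x /\<^sub>R norm x"

definition dist_quat :: "quat \<Rightarrow> quat \<Rightarrow> real" where
  "dist_quat x y = norm (x - y)"

definition uniformity_quat :: "(quat \<times> quat) filter" where
  "uniformity_quat = (INF e\<in>{0 <..}. principal {(x, y). dist x y < e})"

definition open_quat :: "quat set \<Rightarrow> bool" where
  "open_quat U \<longleftrightarrow> (\<forall>x\<in>U. eventually (\<lambda>(x', y). x' = x \<longrightarrow> y \<in> U) uniformity)"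

instance
proof
  fix x y z :: quat and r :: real and U :: "quat set"
  show "dist x y = norm (x - y)" by (rule dist_quat_def)
  show "(uniformity :: (quat \<times> quat) filter) = (INF e\<in>{0 <..}. principal {(x, y). dist x y < e})"
    by (rule uniformity_quat_def)
  show "open U \<longleftrightarrow> (\<forall>x\<in>U. \<forall>\<^sub>F (x', y) in uniformity. x' = x \<longrightarrow> y \<in> U)"
    by (rule open_quat_def)
  show "sgn x = x /\<^sub>R norm x" by (rule sgn_quat_def)
  show "inner x y = inner y x" by (simp add: inner_quat_def mult.commute)
  show "inner (x + y) z = inner x z + inner y z" by (simp add: inner_quat_def algebra_simps)
  show "inner (r *\<^sub>R x) y = r * inner x y" by (simp add: inner_quat_def algebra_simps)
  show "0 \<le> inner x x" by (simp add: inner_quat_def)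
  show "inner x x = 0 \<longleftrightarrow> x = 0"
    by (simp add: inner_quat_def quat_eq_iff add_nonneg_eq_0_iff)
  show "norm x = sqrt (inner x x)" by (rule norm_quat_def)
qed

end

lemma norm_quat_power2:
  "(norm (x::quat))\<^sup>2 = (qRe x)\<^sup>2 + (qIm1 x)\<^sup>2 + (qIm2 x)\<^sup>2 + (qIm3 x)\<^sup>2"
  by (simp add: norm_quat_def inner_quat_def power2_eq_square)

instantiation quat :: inverse
begin

definition inverse_quat :: "quat \<Rightarrow> quat" where
  "inverse_quat x = qcnj x /\<^sub>R (norm x)\<^sup>2"

definition divide_quat :: "quat \<Rightarrow> quat \<Rightarrow> quat" where
  "divide_quat x y = x * inverse y"

instance ..

end

instance quat :: real_normed_div_algebra
proof
  fix x y :: quat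
  have cnj: "qcnj z * z = (norm z)\<^sup>2 *\<^sub>R 1" "z * qcnj z = (norm z)\<^sup>2 *\<^sub>R 1" for z
    unfolding norm_quat_power2 by (simp_all add: quat_eq_iff power2_eq_square)
  show "inverse x * x = 1" if "x \<noteq> 0"
    using that by (simp add: inverse_quat_def cnj)
  show "x * inverse x = 1" if "x \<noteq> 0"
    using that by (simp add: inverse_quat_def cnj)
  show "x / y = x * inverse y" by (rule divide_quat_def)
  show "inverse (0::quat) = 0" by (simp add: inverse_quat_def quat_eq_iff)
  have "(norm (x * y))\<^sup>2 = (norm x * norm y)\<^sup>2"
    unfolding power_mult_distrib norm_quat_power2
    by (simp add: power2_eq_square algebra_simps)
  then show "norm (x * y) = norm x * norm y"
    by (simp add: power2_eq_iff_nonneg)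
qed

instantiation quat :: euclidean_space
begin

definition Basis_quat :: "quat set" where
  "Basis_quat = {Quat 1 0 0 0, Quat 0 1 0 0, Quat 0 0 1 0, Quat 0 0 0 1}"

instance
proof
  show "Basis \<noteq> ({} :: quat set)" "finite (Basis :: quat set)"
    by (simp_all add: Basis_quat_def)
  show "inner u v = (if u = v then 1 else 0)" if "u \<in> Basis" "v \<in> Basis" for u v :: quat
    using that unfolding Basis_quat_def by (elim insertE emptyE) (simp_all add: inner_quat_def)
  show "(\<forall>u\<in>Basis. inner x u = 0) \<longleftrightarrow> x = 0" for x :: quat
    by (simp add: Basis_quat_def inner_quat_def quat_eq_iff[of x])
qed

end

lemma qcnj_mult_self: "qcnj x * x = of_real ((norm x)\<^sup>2)"
  unfolding norm_quat_power2 by (simp add: quat_eq_iff of_real_def power2_eq_square)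

lemma qcnj_mult: "qcnj (x * y) = qcnj y * qcnj x"
  by (simp add: quat_eq_iff algebra_simps)


section \<open>Slices\<close>

definition imag_unit :: "quat \<Rightarrow> bool" where
  "imag_unit I \<longleftrightarrow> I\<^sup>2 = -1"

definition slice_embed :: "quat \<Rightarrow> complex \<Rightarrow> quat" where
  "slice_embed I z = of_real (Re z) + of_real (Im z) * I"

definition slice :: "quat \<Rightarrow> quat set" where
  "slice I = range (slice_embed I)"

text \<open>Lebesgue measure on the slice through \<open>I\<close>, regarded as a Borel measure on the quaternions
  that vanishes off the slice.\<close>

definition slice_lebesgue :: "quat \<Rightarrow> quat measure" where
  "slice_lebesgue I = distr lborel borel (slice_embed I)"

definition slice_norm :: "quat \<Rightarrow> (quat \<Rightarrow> quat) \<Rightarrow> real" where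
  "slice_norm I f =
     sqrt (LINT q:slice I|slice_lebesgue I. (norm (f q))\<^sup>2 * exp (- (norm q)\<^sup>2))"


section \<open>Square integrable quaternion-valued functions on the line\<close>

definition L2_quat :: "(real \<Rightarrow> quat) set" where
  "L2_quat = {f \<in> borel_measurable lborel. integrable lborel (\<lambda>t. (norm (f t))\<^sup>2)}"

definition L2_inner :: "(real \<Rightarrow> quat) \<Rightarrow> (real \<Rightarrow> quat) \<Rightarrow> quat" where
  "L2_inner f g = (LINT t|lborel. qcnj (f t) * g t)"

definition L2_norm :: "(real \<Rightarrow> quat) \<Rightarrow> real" where
  "L2_norm f = sqrt (qRe (L2_inner f f))"

lemma L2_norm_eq:
  assumes "f \<in> L2_quat"
  shows "L2_norm f = sqrt (LINT t|lborel. (norm (f t))\<^sup>2)"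
proof -
  have "integrable lborel (\<lambda>t. (norm (f t))\<^sup>2)"
    using assms by (simp add: L2_quat_def)
  then have "L2_inner f f = (LINT t|lborel. (norm (f t))\<^sup>2) *\<^sub>R 1"
    unfolding L2_inner_def qcnj_mult_self of_real_def by (intro integral_scaleR_left) simp
  then show ?thesis
    by (simp add: L2_norm_def)
qed


section \<open>Hermite polynomials\<close>

fun hermite :: "nat \<Rightarrow> real poly" where
  "hermite 0 = 1"
| "hermite (Suc n) = [:0, 2:] * hermite n - pderiv (hermite n)"

text \<open>Evaluation of a polynomial with real coefficients in a real algebra. The library's
  \<^const>\<open>poly\<close> requires a commutative ring and so does not apply to quaternions.\<close>

definition real_poly_eval :: "real poly \<Rightarrow> 'a::real_algebra_1 \<Rightarrow> 'a" where
  "real_poly_eval p x = (\<Sum>i\<le>degree p. coeff p i *\<^sub>R x ^ i)"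

lemma real_poly_eval_real: "real_poly_eval p (x::real) = poly p x"
  by (simp add: real_poly_eval_def poly_altdef)

lemma real_poly_eval_of_real:
  "real_poly_eval p (of_real x :: 'a::real_algebra_1) = of_real (poly p x)"
  by (simp add: real_poly_eval_def poly_altdef scaleR_conv_of_real)

definition hermite_fun :: "nat \<Rightarrow> real \<Rightarrow> real" where
  "hermite_fun j t = (-1) ^ j * exp (t\<^sup>2 / 2) * (deriv ^^ j) (\<lambda>s. exp (- s\<^sup>2)) t"

lemma hermite_rodrigues:
  "(deriv ^^ j) (\<lambda>s::real. exp (- s\<^sup>2)) = (\<lambda>t. (-1) ^ j * exp (- t\<^sup>2) * poly (hermite j) t)"
proof (induction j)
  case (Suc j)
  have "((\<lambda>t. (-1) ^ j * exp (- t\<^sup>2) * poly (hermite j) t) has_field_derivative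
      (-1) ^ Suc j * exp (- t\<^sup>2) * poly (hermite (Suc j)) t) (at t)" for t :: real
    by (auto intro!: derivative_eq_intros simp: algebra_simps)
  then show ?case
    by (auto simp: Suc.IH DERIV_imp_deriv)
qed simp

lemma hermite_fun_eq: "hermite_fun j t = exp (- t\<^sup>2 / 2) * poly (hermite j) t"
proof -
  have "hermite_fun j t =
      ((-1) ^ j * (-1) ^ j) * (exp (t\<^sup>2 / 2) * exp (- t\<^sup>2)) * poly (hermite j) t"
    unfolding hermite_fun_def hermite_rodrigues by (simp only: mult_ac)
  also have "exp (t\<^sup>2 / 2) * exp (- t\<^sup>2) = exp (- t\<^sup>2 / 2)"
    unfolding mult_exp_exp by (simp add: field_simps)
  finally show ?thesis
    by (simp flip: power_mult_distrib)
qed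

definition hermite_quat :: "nat \<Rightarrow> nat \<Rightarrow> quat \<Rightarrow> quat" where
  "hermite_quat m n q = (fact m * fact n) *\<^sub>R
     (\<Sum>j\<le>min m n. ((-1) ^ j / fact j) *\<^sub>R
        ((q ^ (m - j) * qcnj q ^ (n - j)) /\<^sub>R (fact (m - j) * fact (n - j))))"


section \<open>The kernel\<close>

definition kernel_term :: "quat \<Rightarrow> nat \<Rightarrow> real \<Rightarrow> quat \<Rightarrow> nat \<Rightarrow> quat" where
  "kernel_term I k t q j =
     (hermite_fun j t *\<^sub>R qcnj (hermite_quat j k q))
       /\<^sub>R (L2_norm (\<lambda>s. of_real (hermite_fun j s)) * slice_norm I (hermite_quat j k))"

definition kernel_B2 :: "quat \<Rightarrow> nat \<Rightarrow> real \<Rightarrow> quat \<Rightarrow> quat" where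
  "kernel_B2 I k t q = (\<Sum>j. kernel_term I k t q j)"

end

theory Submission
  imports Defs "HOL-Computational_Algebra.Formal_Laurent_Series" "HOL-Probability.Distributions"
begin

text \<open>The coefficients of the series are \<open>H\<^sub>j(t) / (\<surd>2\<^sup>j j!)\<close> up to a factor independent of \<open>j\<close>, so
  for \<open>k = 0\<close> the kernel is the generating function of the Hermite polynomials evaluated at
  \<open>cnj q / \<surd>2\<close>. Three-term recurrences carry this to all \<open>k\<close> without differentiating the series:
  as \<open>q + cnj q\<close> is real, everything in sight commutes. The norm on a slice reduces to
  the vanishing of the Gaussian integral of \<open>z\<^sup>a (cnj z)\<^sup>b\<close> for \<open>a \<noteq> b\<close>, a consequence of integration by
  parts. Finally the modulus of the closed form, as a function of
  \<open>t\<close>, is a multiple of the modulus of the Hermite function \<open>h\<^sub>k\<close> reflected and translated to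
  \<open>\<surd>2 Re q\<close>, whence its norm.\<close>

section \<open>Hermite polynomials and their generating functions\<close>

text \<open>Differentiating the recurrence leaves a second derivative, which the induction
  hypothesis turns into a multiple of \<open>pderiv (hermite n)\<close>; the recurrence then
  reassembles \<open>hermite (Suc n)\<close>.\<close>

lemma pderiv_hermite_Suc: "pderiv (hermite (Suc n)) = smult (2 * (real n + 1)) (hermite n)"
proof (induction n)
  case (Suc n)
  have "pderiv (hermite (Suc (Suc n))) =
      smult 2 (hermite (Suc n)) + [:0, 2:] * pderiv (hermite (Suc n))
        - pderiv (pderiv (hermite (Suc n)))"
    by (simp only: hermite.simps(2)[of "Suc n"] pderiv_diff pderiv_mult) (simp add: pderiv_pCons)
  also have "\<dots> = smult 2 (hermite (Suc n)) + smult (2 * (real n + 1)) (hermite (Suc n))"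
    unfolding Suc.IH
    by (simp add: pderiv_smult smult_diff_right algebra_simps del: mult_pCons_left)
  also have "\<dots> = smult (2 * (real (Suc n) + 1)) (hermite (Suc n))"
    by (simp add: smult_add_left[symmetric] del: hermite.simps)
  finally show ?case .
qed (simp add: pderiv_pCons one_pCons)

lemma poly_hermite_Suc:
  "poly (hermite (Suc n)) x = 2 * x * poly (hermite n) x - 2 * real n * poly (hermite (n - 1)) x"
proof (cases n)
  case (Suc m)
  show ?thesis
    unfolding hermite.simps(2)[of n] unfolding Suc pderiv_hermite_Suc
    by (simp add: mult_ac del: hermite.simps)
qed simp

text \<open>The product is the formal \<open>exp (2 t X - X^2)\<close>. Its differential equation
  \<open>C' = (2 t - 2 X) C\<close> is, coefficient by coefficient, the three-term recurrence of the
  Hermite polynomials.\<close>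

lemma fps_hermite:
  "fps_exp (2 * t) * (fps_exp (-1) oo fps_X ^ 2) = Abs_fps (\<lambda>n. poly (hermite n) t / fact n)"
  (is "?C = _")
proof -
  let ?B = "fps_exp (-1 :: real) oo fps_X ^ 2"
  have "fps_deriv ?B = - (fps_const 2 * fps_X * ?B)"
    by (simp add: fps_compose_deriv fps_deriv_power fps_compose_mult_distrib numeral_fps_const
        fps_compose_uminus flip: fps_const_neg)
  then have deriv: "fps_deriv ?C = fps_const (2 * t) * ?C - fps_const 2 * (fps_X * ?C)"
    by (simp add: algebra_simps)
  have step: "real (n + 1) * fps_nth ?C (n + 1) =
      2 * t * fps_nth ?C n - 2 * (if n = 0 then 0 else fps_nth ?C (n - 1))" for n
    using arg_cong[OF deriv, of "\<lambda>f. fps_nth f n"]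
    by (simp only: fps_deriv_nth fps_sub_nth fps_mult_left_const_nth fps_X_mult_nth of_nat_id)
  \<comment> \<open>Two consecutive coefficients go through the induction together, the recurrence
    being of second order.\<close>
  have "fps_nth ?C n = poly (hermite n) t / fact n \<and>
      fps_nth ?C (Suc n) = poly (hermite (Suc n)) t / fact (Suc n)" for n
  proof (induction n)
    case 0
    then show ?case using step[of 0] by simp
  next
    case (Suc n)
    have nz: "1 + real n \<noteq> 0" "2 + real n \<noteq> 0" by simp_all
    have "(2 + real n) * fps_nth ?C (Suc (Suc n)) =
        2 * t * (poly (hermite (Suc n)) t / fact (Suc n)) - 2 * (poly (hermite n) t / fact n)"
      using step[of "Suc n"] Suc by (simp del: hermite.simps fact_Suc)
    also have "\<dots> = poly (hermite (Suc (Suc n))) t / fact (Suc n)"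
      unfolding poly_hermite_Suc[of "Suc n"]
      by (simp add: divide_simps nz del: hermite.simps)
    finally have "fps_nth ?C (Suc (Suc n)) * (2 + real n) = poly (hermite (Suc (Suc n))) t / fact (Suc n)"
      by (simp only: mult.commute[of _ "2 + real n"])
    then have "fps_nth ?C (Suc (Suc n)) = poly (hermite (Suc (Suc n))) t / fact (Suc n) / (2 + real n)"
      by (simp only: nonzero_eq_divide_eq[OF nz(2)])
    also have "\<dots> = poly (hermite (Suc (Suc n))) t / fact (Suc (Suc n))"
      unfolding fact_Suc[of "Suc n"] by (simp add: mult.commute del: hermite.simps fact_Suc)
    finally show ?case using Suc by blast
  qed
  then show ?thesis by (simp add: fps_eq_iff)
qed

text \<open>Cauchy product of the absolutely convergent series of \<open>exp (2 t y)\<close> and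
  \<open>exp (- y^2)\<close>, with coefficients from \<open>fps_hermite\<close>. The Banach algebra
  allows \<open>y\<close> to be a quaternion.\<close>

lemma hermite_generating_function:
  fixes y :: "'a :: {real_normed_algebra_1, banach}"
  shows "(\<lambda>n. (poly (hermite n) t / fact n) *\<^sub>R y ^ n) sums exp ((2 * t) *\<^sub>R y - y\<^sup>2)"
proof -
  let ?B = "fps_exp (-1 :: real) oo fps_X ^ 2"
  define a where "a n = fps_nth (fps_exp (2 * t)) n *\<^sub>R y ^ n" for n
  define b where "b n = fps_nth ?B n *\<^sub>R y ^ n" for n
  have a_eq: "a n = ((2 * t) *\<^sub>R y) ^ n /\<^sub>R fact n" for n
    by (simp add: a_def scaleR_power divide_inverse mult.commute)
  have a: "a sums exp ((2 * t) *\<^sub>R y)" "summable (\<lambda>n. norm (a n))"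
    unfolding a_eq by (rule exp_converges, rule summable_norm_exp)
  have B_nth: "fps_nth ?B n = (if even n then (-1) ^ (n div 2) / fact (n div 2) else 0)" for n
    by (simp add: fps_nth_compose_X_power)
  have mono: "strict_mono (\<lambda>n::nat. 2 * n)"
    by (auto simp: strict_mono_def)
  \<comment> \<open>\<open>b\<close> is the series of \<open>exp (- y^2)\<close> spread over the
    even indices, so its sum follows by reindexing.\<close>
  have b0: "b n = 0" if "n \<notin> range (\<lambda>n. 2 * n)" for n
    using that by (auto simp: b_def B_nth elim: evenE)
  have b_even: "b (2 * n) = (- y\<^sup>2) ^ n /\<^sub>R fact n" for n
    by (cases "even n")
      (auto simp: b_def B_nth power_mult[of y 2] divide_inverse power_minus[of "y\<^sup>2"])
  have b: "b sums exp (- y\<^sup>2)"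
    using sums_mono_reindex[OF mono, of b] b0 exp_converges[of "- y\<^sup>2"] by (simp add: b_even)
  have b': "summable (\<lambda>n. norm (b n))"
    using summable_mono_reindex[OF mono, of "\<lambda>n. norm (b n)"] b0 summable_norm_exp[of "- y\<^sup>2"]
    by (simp add: b_even)
  have "(\<lambda>n. \<Sum>i\<le>n. a i * b (n - i)) sums (exp ((2 * t) *\<^sub>R y) * exp (- y\<^sup>2))"
    using Cauchy_product_sums[OF a(2) b'] a(1) b by (simp add: sums_iff)
  also have "(\<lambda>n. \<Sum>i\<le>n. a i * b (n - i)) = (\<lambda>n. (poly (hermite n) t / fact n) *\<^sub>R y ^ n)"
  proof
    fix n
    have "(\<Sum>i\<le>n. a i * b (n - i)) =
        (\<Sum>i\<le>n. (fps_nth (fps_exp (2 * t)) i * fps_nth ?B (n - i)) *\<^sub>R y ^ n)"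
      by (intro sum.cong) (simp_all add: a_def b_def flip: power_add)
    also have "\<dots> = fps_nth (fps_exp (2 * t) * ?B) n *\<^sub>R y ^ n"
      by (simp add: fps_mult_nth scaleR_sum_left atMost_atLeast0)
    finally show "(\<Sum>i\<le>n. a i * b (n - i)) = (poly (hermite n) t / fact n) *\<^sub>R y ^ n"
      by (simp add: fps_hermite)
  qed
  also have "exp ((2 * t) *\<^sub>R y) * exp (- y\<^sup>2) = exp ((2 * t) *\<^sub>R y + - y\<^sup>2)"
    by (rule exp_add_commuting[symmetric]) (simp add: power2_eq_square mult.assoc)
  finally show ?thesis by simp
qed

section \<open>Hermite polynomials in two variables\<close>

text \<open>The order of the factors matters, as \<open>x\<close> and \<open>y\<close> need not commute. The sum may be taken up to
  \<open>n\<close> because \<open>m choose i\<close> vanishes for \<open>i > m\<close>.\<close>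

definition hermite2 :: "nat \<Rightarrow> nat \<Rightarrow> 'a::real_algebra_1 \<Rightarrow> 'a \<Rightarrow> 'a" where
  "hermite2 m n x y =
     (\<Sum>i\<le>n. ((-1) ^ i * fact i * real (m choose i) * real (n choose i)) *\<^sub>R
        (x ^ (m - i) * y ^ (n - i)))"

lemma hermite2_0_right [simp]: "hermite2 m 0 x y = x ^ m"
  by (simp add: hermite2_def)

text \<open>A bound symmetric in \<open>m\<close> and \<open>n\<close>, such as
  \<open>m + n\<close>, lets sums with exchanged indices be compared term by term.\<close>

lemma hermite2_atMost:
  assumes "min m n \<le> N"
  shows "hermite2 m n x y =
     (\<Sum>i\<le>N. ((-1) ^ i * fact i * real (m choose i) * real (n choose i)) *\<^sub>R
        (x ^ (m - i) * y ^ (n - i)))"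
proof -
  let ?f = "\<lambda>i. ((-1) ^ i * fact i * real (m choose i) * real (n choose i)) *\<^sub>R
        (x ^ (m - i) * y ^ (n - i))"
  have "sum ?f {..n} = sum ?f {..min m n}" "sum ?f {..N} = sum ?f {..min m n}"
    by (rule sum.mono_neutral_right; use assms in \<open>auto simp: min_def split: if_splits\<close>)+
  then show ?thesis by (simp add: hermite2_def)
qed

lemma hermite2_swap:
  assumes "x * y = y * x"
  shows "hermite2 m n x y = hermite2 n m y x"
proof -
  have comm: "x ^ a * y ^ b = y ^ b * x ^ a" for a b
    using assms by (metis power_commuting_commutes)
  show ?thesis
    by (simp add: hermite2_atMost[of m n "m + n"] hermite2_atMost[of n m "m + n"] comm mult_ac)
qed

lemma hermite2_0_left: "hermite2 0 n x y = y ^ n"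
  by (simp add: hermite2_atMost[of 0 n 0])

text \<open>Pascal's rule for \<open>Suc n choose i\<close> splits the sum: one half is the old sum
  with \<open>y\<close> appended on the right, the other is shifted by one and reduced by the
  absorption \<open>(i + 1) (m choose (i + 1)) = m ((m - 1) choose i)\<close>. At
  \<open>m = 0\<close> the truncated \<open>m - 1\<close> meets the coefficient zero.\<close>

lemma hermite2_Suc:
  "hermite2 m (Suc n) x y = hermite2 m n x y * y - real m *\<^sub>R hermite2 (m - 1) n x y"
proof -
  let ?c = "\<lambda>i. (-1) ^ i * fact i * real (m choose i)"
  let ?p = "\<lambda>i. x ^ (m - i) * y ^ (Suc n - i)"
  have "hermite2 m (Suc n) x y =
      (\<Sum>i\<le>Suc n. (?c i * real (n choose i)) *\<^sub>R ?p i)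
      + (\<Sum>i\<le>Suc n. (?c i * real (if i = 0 then 0 else n choose (i - 1))) *\<^sub>R ?p i)"
    unfolding hermite2_def sum.distrib[symmetric] scaleR_add_left[symmetric]
  proof (intro sum.cong refl)
    fix i
    show "(?c i * real (Suc n choose i)) *\<^sub>R ?p i =
        (?c i * real (n choose i) + ?c i * real (if i = 0 then 0 else n choose (i - 1))) *\<^sub>R ?p i"
      by (cases i) (simp_all add: algebra_simps)
  qed
  \<comment> \<open>The top summand vanishes because \<open>n choose Suc n = 0\<close>.\<close>
  also have "(\<Sum>i\<le>Suc n. (?c i * real (n choose i)) *\<^sub>R ?p i) = hermite2 m n x y * y"
    by (simp add: hermite2_def sum_distrib_right Suc_diff_le mult.assoc power_Suc2 del: power_Suc)
  also have "(\<Sum>i\<le>Suc n. (?c i * real (if i = 0 then 0 else n choose (i - 1))) *\<^sub>R ?p i)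
      = (\<Sum>i\<le>n. (?c (Suc i) * real (n choose i)) *\<^sub>R ?p (Suc i))"
    by (subst sum.atMost_Suc_shift) simp
  also have "\<dots> = (\<Sum>i\<le>n. - (real m *\<^sub>R (((-1) ^ i * fact i * real ((m - 1) choose i) * real (n choose i)) *\<^sub>R
        (x ^ (m - 1 - i) * y ^ (n - i)))))"
  proof (intro sum.cong refl)
    fix i
    have "real (Suc i) * real (m choose Suc i) = real m * real ((m - 1) choose i)"
      by (simp only: binomial_absorption flip: of_nat_mult)
    from arg_cong[OF this, of "\<lambda>r. (-1) ^ i * fact i * r"] have "?c (Suc i) = - (real m * ((-1) ^ i * fact i * real ((m - 1) choose i)))"
      by (simp add: algebra_simps)
    then show "(?c (Suc i) * real (n choose i)) *\<^sub>R ?p (Suc i) =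
      - (real m *\<^sub>R (((-1) ^ i * fact i * real ((m - 1) choose i) * real (n choose i)) *\<^sub>R
        (x ^ (m - 1 - i) * y ^ (n - i))))"
      by (simp add: mult.assoc)
  qed
  also have "\<dots> = - (real m *\<^sub>R hermite2 (m - 1) n x y)"
    by (simp add: hermite2_def sum_negf scaleR_sum_right)
  finally show ?thesis by simp
qed

lemma hermite2_Suc_left:
  assumes "x * y = y * x"
  shows "hermite2 (Suc m) n x y = hermite2 m n x y * x - real n *\<^sub>R hermite2 m (n - 1) x y"
  by (simp add: hermite2_swap[OF assms] hermite2_Suc)

text \<open>The factorials combine as \<open>m! n! / (i! (m - i)! (n - i)!) = i! (m choose i) (n
  choose i)\<close>.\<close>

lemma hermite_quat_eq: "hermite_quat m n q = hermite2 m n q (qcnj q)"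
  unfolding hermite2_atMost[of m n "min m n", OF order_refl] hermite_quat_def scaleR_sum_right
proof (intro sum.cong refl)
  fix i assume "i \<in> {..min m n}"
  then have "i \<le> m" "i \<le> n" by auto
  then show "(fact m * fact n) *\<^sub>R ((- 1) ^ i / fact i) *\<^sub>R
      ((q ^ (m - i) * qcnj q ^ (n - i)) /\<^sub>R (fact (m - i) * fact (n - i))) =
    ((- 1) ^ i * fact i * real (m choose i) * real (n choose i)) *\<^sub>R (q ^ (m - i) * qcnj q ^ (n - i))"
    by (simp add: binomial_fact divide_simps)
qed

lemma bounded_linear_qcnj: "bounded_linear qcnj"
  by (rule bounded_linear_intro[of _ 1])
    (simp_all add: quat_eq_iff norm_quat_def inner_quat_def)

lemma qcnj_power: "qcnj (x ^ n) = qcnj x ^ n"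
  by (induction n) (simp_all add: qcnj_mult power_commutes quat_eq_iff[of "qcnj 1"])

lemma qcnj_qcnj [simp]: "qcnj (qcnj x) = x"
  by (simp add: quat_eq_iff)

text \<open>Conjugation reverses products, which exchanges the roles of the two indices. At
  \<open>x = q\<close>, \<open>y = qcnj q\<close> the arguments stay put, so the summation index of
  the kernel becomes the second one.\<close>

lemma qcnj_hermite2: "qcnj (hermite2 m n x y) = hermite2 n m (qcnj y) (qcnj x)"
proof -
  interpret bounded_linear qcnj by (rule bounded_linear_qcnj)
  show ?thesis
    by (simp add: hermite2_atMost[of m n "m + n"] hermite2_atMost[of n m "m + n"] sum scaleR
        qcnj_mult qcnj_power mult_ac)
qed

text \<open>Induction on \<open>k\<close>, both sides obeying \<open>S\<^bsub>k+1\<^esub> = (s - \<surd>2 t) S\<^bsub>k\<^esub> - k S\<^bsub>k-1\<^esub>\<close>; on the left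
  this combines the three recurrences of the two families of Hermite polynomials.\<close>

lemma hermite2_generating_function:
  fixes x y :: "'a :: {real_normed_algebra_1, banach}"
  assumes xy: "x + y = of_real s"
  shows "(\<lambda>j. (poly (hermite j) t / (sqrt 2 ^ j * fact j)) *\<^sub>R hermite2 k j x y) sums
     ((poly (hermite k) (s / sqrt 2 - t) / sqrt 2 ^ k) *\<^sub>R exp ((sqrt 2 * t) *\<^sub>R y - y\<^sup>2 /\<^sub>R 2))"
proof -
  define E where "E = exp ((sqrt 2 * t) *\<^sub>R y - y\<^sup>2 /\<^sub>R 2)"
  define c where "c j = poly (hermite j) t / (sqrt 2 ^ j * fact j)" for j
  define T where "T k = poly (hermite k) (s / sqrt 2 - t) / sqrt 2 ^ k" for k
  have x: "x = of_real s - y"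
    using xy by (simp add: eq_diff_eq)
  \<comment> \<open>The real number \<open>s\<close> is central.\<close>
  have comm: "x * y = y * x"
    unfolding x by (simp add: algebra_simps of_real_def)
  have sqrt2: "sqrt 2 * (sqrt 2 * z) = 2 * z" for z
    by (simp flip: mult.assoc)
  have T_Suc: "T (Suc k) = (s - sqrt 2 * t) * T k - real k * T (k - 1)" for k
    unfolding T_def poly_hermite_Suc by (cases k) (simp_all add: field_simps sqrt2)
  have c_Suc: "real (Suc j) * c (Suc j) = sqrt 2 * t * c j - (if j = 0 then 0 else c (j - 1))" for j
  proof (cases j)
    case 0
    then show ?thesis by (simp add: c_def field_simps sqrt2)
  next
    case (Suc l)
    have nz: "1 + real l \<noteq> 0" by simp
    have "real (Suc j) * c (Suc j) =
        (2 * t * poly (hermite j) t - 2 * real j * poly (hermite (j - 1)) t) / (sqrt 2 ^ Suc j * fact j)"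
      unfolding c_def poly_hermite_Suc
      by (simp del: hermite.simps power_Suc of_nat_Suc)
    then show ?thesis
      unfolding c_def Suc
      by (simp add: divide_simps nz del: hermite.simps)
  qed
  have "(\<lambda>j. c j *\<^sub>R hermite2 k j x y) sums (T k *\<^sub>R E) \<and>
        (\<lambda>j. c j *\<^sub>R hermite2 (Suc k) j x y) sums (T (Suc k) *\<^sub>R E)" for k
  proof -
    \<comment> \<open>Let \<open>S k\<close> be the series. \<open>hermite2_Suc_left\<close> gives
      \<open>S (k + 1) = S k * x\<close> minus the sum of
      \<open>(j + 1) c (j + 1) hermite2 k j\<close>; by \<open>c_Suc\<close> that sum is
      \<open>sqrt 2 t S k\<close> minus a shifted series, which \<open>hermite2_Suc\<close>
      evaluates to \<open>S k * y - k S (k - 1)\<close>.\<close>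
    have step: "(\<lambda>j. c j *\<^sub>R hermite2 (Suc k) j x y) sums (T (Suc k) *\<^sub>R E)"
      if k: "(\<lambda>j. c j *\<^sub>R hermite2 k j x y) sums (T k *\<^sub>R E)"
        and k': "k > 0 \<Longrightarrow> (\<lambda>j. c j *\<^sub>R hermite2 (k - 1) j x y) sums (T (k - 1) *\<^sub>R E)" for k
    proof -
      have kk: "(\<lambda>j. real k *\<^sub>R (c j *\<^sub>R hermite2 (k - 1) j x y)) sums (real k *\<^sub>R (T (k - 1) *\<^sub>R E))"
        using sums_scaleR_right[OF k', of "real k"] by (cases "k > 0") simp_all
      have "(\<lambda>j. (c j *\<^sub>R hermite2 k j x y) * y - real k *\<^sub>R (c j *\<^sub>R hermite2 (k - 1) j x y))
          sums ((T k *\<^sub>R E) * y - real k *\<^sub>R (T (k - 1) *\<^sub>R E))"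
        by (intro sums_diff sums_mult2 k kk)
      then have "(\<lambda>j. c j *\<^sub>R hermite2 k (Suc j) x y)
          sums ((T k *\<^sub>R E) * y - real k *\<^sub>R (T (k - 1) *\<^sub>R E))"
        by (simp add: hermite2_Suc algebra_simps)
      \<comment> \<open>A zero prepended at \<open>j = 0\<close> aligns \<open>c (j - 1)\<close>
        with \<open>hermite2 k j\<close>.\<close>
      from sums_Suc[where f = "\<lambda>j. if j = 0 then 0 else c (j - 1) *\<^sub>R hermite2 k j x y"] this
      have "(\<lambda>j. if j = 0 then 0 else c (j - 1) *\<^sub>R hermite2 k j x y)
          sums ((T k *\<^sub>R E) * y - real k *\<^sub>R (T (k - 1) *\<^sub>R E))"
        by force
      from sums_diff[OF sums_scaleR_right[OF k, of "sqrt 2 * t"] this]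
      have "(\<lambda>j. (real (Suc j) * c (Suc j)) *\<^sub>R hermite2 k j x y)
          sums ((sqrt 2 * t) *\<^sub>R (T k *\<^sub>R E) - ((T k *\<^sub>R E) * y - real k *\<^sub>R (T (k - 1) *\<^sub>R E)))"
        by (rule sums_cong[THEN iffD1, rotated]) (simp only: c_Suc, simp add: algebra_simps)
      \<comment> \<open>Here the factor \<open>real j\<close> supplies the zero term at
        \<open>j = 0\<close>.\<close>
      from sums_Suc[where f = "\<lambda>j. (real j * c j) *\<^sub>R hermite2 k (j - 1) x y"] this
      have "(\<lambda>j. (real j * c j) *\<^sub>R hermite2 k (j - 1) x y)
          sums ((sqrt 2 * t) *\<^sub>R (T k *\<^sub>R E) - ((T k *\<^sub>R E) * y - real k *\<^sub>R (T (k - 1) *\<^sub>R E)))"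
        by force
      from sums_diff[OF sums_mult2[OF k, of x] this]
      have "(\<lambda>j. c j *\<^sub>R hermite2 (Suc k) j x y) sums ((T k *\<^sub>R E) * x -
          ((sqrt 2 * t) *\<^sub>R (T k *\<^sub>R E) - ((T k *\<^sub>R E) * y - real k *\<^sub>R (T (k - 1) *\<^sub>R E))))"
        by (simp add: hermite2_Suc_left[OF comm] algebra_simps)
      also have "(T k *\<^sub>R E) * x -
          ((sqrt 2 * t) *\<^sub>R (T k *\<^sub>R E) - ((T k *\<^sub>R E) * y - real k *\<^sub>R (T (k - 1) *\<^sub>R E)))
          = T (Suc k) *\<^sub>R E"
        unfolding x T_Suc by (simp add: algebra_simps of_real_def)
      finally show ?thesis .
    qed
    have t2: "t * 2 / sqrt 2 = t * sqrt 2"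
      by (simp add: field_simps)
    \<comment> \<open>For \<open>k = 0\<close> the terms are powers of \<open>y\<close>, and the
      one-variable generating function applies at \<open>y / sqrt 2\<close>.\<close>
    have "(\<lambda>j. c j *\<^sub>R hermite2 0 j x y) sums (T 0 *\<^sub>R E)"
      using hermite_generating_function[of t "y /\<^sub>R sqrt 2"] t2
      by (simp add: c_def T_def E_def hermite2_0_left scaleR_power power_inverse field_simps
           real_div_sqrt)
    then show ?thesis
      by (induction k) (auto intro: step simp del: hermite.simps)
  qed
  then show ?thesis by (simp add: c_def T_def E_def)
qed

section \<open>Gaussian integrals\<close>

definition gauss_moment :: "nat \<Rightarrow> real" where
  "gauss_moment n = (LINT x|lborel. exp (- x\<^sup>2) * x ^ n)"

lemma has_bochner_integral_gauss_even:
  "has_bochner_integral lborel (\<lambda>x::real. exp (- x\<^sup>2) * x ^ (2 * k))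
     (sqrt pi * (fact (2 * k) / (2 ^ (2 * k) * fact k)))"
  using has_bochner_integral_even_function[OF gaussian_moment_even_pos[of k]] by simp

lemma has_bochner_integral_gauss_odd:
  "has_bochner_integral lborel (\<lambda>x::real. exp (- x\<^sup>2) * x ^ (2 * k + 1)) 0"
  by (rule has_bochner_integral_odd_function[OF gaussian_moment_odd_pos[of k]]) simp

lemma integrable_gauss_power: "integrable lborel (\<lambda>x::real. exp (- x\<^sup>2) * x ^ n)"
proof (cases "even n")
  case True
  then obtain k where "n = 2 * k" by (elim evenE)
  then show ?thesis using integrable.intros[OF has_bochner_integral_gauss_even] by blast
next
  case False
  then obtain k where "n = 2 * k + 1" by (elim oddE)
  then show ?thesis using integrable.intros[OF has_bochner_integral_gauss_odd] by blast
qed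

lemma gauss_moment_even: "gauss_moment (2 * k) = sqrt pi * (fact (2 * k) / (2 ^ (2 * k) * fact k))"
  unfolding gauss_moment_def
  by (rule has_bochner_integral_integral_eq[OF has_bochner_integral_gauss_even])

lemma gauss_moment_odd: "gauss_moment (2 * k + 1) = 0"
  unfolding gauss_moment_def
  by (rule has_bochner_integral_integral_eq[OF has_bochner_integral_gauss_odd])

lemma gauss_moment_0: "gauss_moment 0 = sqrt pi"
  using gauss_moment_even[of 0] by simp

text \<open>Integration by parts for monomials, read off from the explicit moments: for even
  \<open>n\<close> both sides vanish (at \<open>n = 0\<close> through the factor
  \<open>real n\<close>), for odd \<open>n\<close> the factorials are compared.\<close>

lemma gauss_moment_Suc: "2 * gauss_moment (Suc n) = real n * gauss_moment (n - 1)"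
proof (cases "even n")
  case True
  then obtain k where k: "n = 2 * k" by (elim evenE)
  show ?thesis
  proof (cases k)
    case 0
    then show ?thesis using k gauss_moment_odd[of 0] by simp
  next
    case (Suc l)
    then show ?thesis using k gauss_moment_odd[of k] gauss_moment_odd[of l] by simp
  qed
next
  case False
  then obtain k where k: "n = 2 * k + 1" by (elim oddE)
  have nz: "1 + real k \<noteq> 0" by simp
  have fact_2Suc: "(fact (2 * Suc k) :: real) = 2 * (1 + real k) * (2 * real k + 1) * fact (2 * k)" for k
    by (simp add: algebra_simps)
  have "gauss_moment (Suc n) = gauss_moment (2 * Suc k)" using k by simp
  also have "2 * \<dots> = real n * gauss_moment (2 * k)"
    using fact_2Suc[of k] nz unfolding gauss_moment_even k
    by (simp add: divide_simps)
  finally show ?thesis using k by simp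
qed

section \<open>Gaussian norm of the Hermite polynomials\<close>

definition gauss_poly :: "real poly \<Rightarrow> real" where
  "gauss_poly p = (LINT x|lborel. exp (- x\<^sup>2) * poly p x)"

lemma integrable_gauss_poly: "integrable lborel (\<lambda>x::real. exp (- x\<^sup>2) * poly p x)"
  unfolding poly_altdef sum_distrib_left
  by (intro Bochner_Integration.integrable_sum)
    (simp add: mult.left_commute integrable_gauss_power)

lemma gauss_poly_add: "gauss_poly (p + q) = gauss_poly p + gauss_poly q"
  by (simp add: gauss_poly_def distrib_left integrable_gauss_poly)

lemma gauss_poly_diff: "gauss_poly (p - q) = gauss_poly p - gauss_poly q"
  by (simp add: gauss_poly_def right_diff_distrib integrable_gauss_poly)

lemma gauss_poly_smult: "gauss_poly (smult c p) = c * gauss_poly p"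
  by (simp add: gauss_poly_def mult.left_commute)

lemma gauss_poly_monom: "gauss_poly (monom c n) = c * gauss_moment n"
  by (simp add: gauss_poly_def gauss_moment_def poly_monom mult.left_commute)

text \<open>Both sides are linear in \<open>p\<close>, and on monomials the claim is
  \<open>gauss_moment_Suc\<close>.\<close>

lemma gauss_poly_by_parts: "gauss_poly ([:0, 2:] * p) = gauss_poly (pderiv p)"
proof -
  let ?Q = "\<lambda>p. gauss_poly ([:0, 2:] * p) = gauss_poly (pderiv p)"
  have Q0: "?Q 0"
    by (simp add: gauss_poly_def)
  have "?Q (monom c n)" for c n
  proof -
    have "[:0, 2:] * monom c n = monom (2 * c) (Suc n)"
      by (simp add: monom_Suc smult_monom)
    then show ?thesis
      using gauss_moment_Suc[of n] by (simp add: gauss_poly_monom pderiv_monom mult_ac)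
  qed
  then have monom: "?Q (monom c n)" for c n .
  have add: "?Q (p + q)" if "?Q p" "?Q q" for p q
    using that by (simp only: distrib_left pderiv_add gauss_poly_add)
  have "?Q (\<Sum>i\<in>A. monom (coeff p i) i)" if "finite A" for A
    using that
  proof (induction A rule: finite_induct)
    case empty
    show ?case using Q0 by (simp only: sum.empty)
  next
    case (insert i A)
    show ?case unfolding sum.insert[OF insert.hyps] by (rule add[OF monom insert.IH])
  qed
  from this[of "{..degree p}"] show ?thesis
    by (simp only: poly_as_sum_of_monoms finite_atMost)
qed

text \<open>In \<open>H (n+1) p = 2 x (H n p) - (H n p)' + H n p'\<close> the first two terms cancel
  under the integral, so lowering the Hermite index costs a derivative of \<open>p\<close>.\<close>

lemma gauss_poly_hermite_mult: "gauss_poly (hermite (Suc n) * p) = gauss_poly (hermite n * pderiv p)"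
proof -
  have "hermite (Suc n) * p = [:0, 2:] * (hermite n * p) - pderiv (hermite n * p) + hermite n * pderiv p"
    by (simp add: pderiv_mult algebra_simps)
  then show ?thesis
    by (simp only: gauss_poly_add gauss_poly_diff gauss_poly_by_parts diff_self add_0)
qed

lemma gauss_poly_hermite_square: "gauss_poly (hermite n * hermite n) = 2 ^ n * fact n * sqrt pi"
proof (induction n)
  case 0
  show ?case using gauss_poly_monom[of 1 0] by (simp add: gauss_moment_0)
next
  case (Suc n)
  then show ?case
    by (simp add: gauss_poly_hermite_mult pderiv_hermite_Suc gauss_poly_smult algebra_simps
        del: hermite.simps)
qed

lemma has_bochner_integral_hermite_square:
  "has_bochner_integral lborel (\<lambda>x. exp (- x\<^sup>2) * (poly (hermite n) x)\<^sup>2) (2 ^ n * fact n * sqrt pi)"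
  using gauss_poly_hermite_square[of n] integrable_gauss_poly[of "hermite n * hermite n"]
  by (simp add: has_bochner_integral_iff gauss_poly_def power2_eq_square)

section \<open>Gaussian moments on the complex plane\<close>

text \<open>Lebesgue measure on the plane is the image of the product measure indexed by the basis
  \<open>1\<close>, \<open>\<i>\<close>, over which the integrand factorises.\<close>

lemma has_bochner_integral_complex_gauss:
  "has_bochner_integral lborel (\<lambda>z::complex. exp (- (norm z)\<^sup>2) * (Re z ^ i * Im z ^ j))
     (gauss_moment i * gauss_moment j)"
proof -
  interpret product_sigma_finite "\<lambda>_::complex. lborel :: real measure" ..
  define f where "f b x = exp (- x\<^sup>2) * (if b = 1 then x ^ i else x ^ j)" for b :: complex and x :: real
  have int: "integrable lborel (f b)" for b
    using integrable_gauss_power[of i] integrable_gauss_power[of j]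
    by (cases "b = 1") (simp_all add: f_def[abs_def])
  let ?T = "\<lambda>x. \<Sum>b\<in>Basis. x b *\<^sub>R b :: complex"
  have T: "?T x = Complex (x 1) (x \<i>)" for x
    by (simp add: Basis_complex_def complex_eq_iff)
  have "has_bochner_integral (\<Pi>\<^sub>M b\<in>(Basis :: complex set). lborel) (\<lambda>x. \<Prod>b\<in>Basis. f b (x b))
      (\<Prod>b\<in>(Basis :: complex set). integral\<^sup>L lborel (f b))"
    by (simp add: has_bochner_integral_iff product_integrable_prod product_integral_prod int)
  also have "(\<Prod>b\<in>(Basis :: complex set). integral\<^sup>L lborel (f b)) = gauss_moment i * gauss_moment j"
    by (simp add: Basis_complex_def f_def[abs_def] gauss_moment_def)
  also have "(\<lambda>x. \<Prod>b\<in>Basis. f b (x b)) =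
      (\<lambda>x. exp (- (norm (?T x))\<^sup>2) * (Re (?T x) ^ i * Im (?T x) ^ j))"
    unfolding T by (auto simp: Basis_complex_def f_def cmod_power2 exp_diff exp_minus field_simps
        simp flip: exp_add)
  finally show ?thesis
    unfolding lborel_eq[where 'a = complex]
    by (intro has_bochner_integral_distr) measurable
qed

text \<open>Weighting by monomials in the real and imaginary parts makes integration by parts in the
  two variables accessible to induction on \<open>a\<close> and \<open>b\<close>.\<close>

definition gauss_mono :: "nat \<Rightarrow> nat \<Rightarrow> nat \<Rightarrow> nat \<Rightarrow> complex \<Rightarrow> complex" where
  "gauss_mono a b i j z =
     exp (- (norm z)\<^sup>2) *\<^sub>R (z ^ a * cnj z ^ b * of_real (Re z ^ i * Im z ^ j))"

lemma gauss_mono_Suc_1: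
  "gauss_mono (Suc a) b i j z = gauss_mono a b (Suc i) j z + \<i> * gauss_mono a b i (Suc j) z"
proof -
  have "gauss_mono (Suc a) b i j z = (of_real (Re z) + \<i> * of_real (Im z)) * gauss_mono a b i j z"
    by (simp add: gauss_mono_def flip: complex_eq)
  also have "\<dots> = gauss_mono a b (Suc i) j z + \<i> * gauss_mono a b i (Suc j) z"
    by (simp add: gauss_mono_def algebra_simps scaleR_conv_of_real)
  finally show ?thesis .
qed

lemma gauss_mono_Suc_2:
  "gauss_mono a (Suc b) i j z = gauss_mono a b (Suc i) j z - \<i> * gauss_mono a b i (Suc j) z"
proof -
  have "cnj z = of_real (Re z) - \<i> * of_real (Im z)"
    by (simp add: complex_eq_iff)
  then have "gauss_mono a (Suc b) i j z =
      (of_real (Re z) - \<i> * of_real (Im z)) * gauss_mono a b i j z"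
    by (simp add: gauss_mono_def flip: \<open>cnj z = _\<close>)
  also have "\<dots> = gauss_mono a b (Suc i) j z - \<i> * gauss_mono a b i (Suc j) z"
    by (simp add: gauss_mono_def algebra_simps scaleR_conv_of_real)
  finally show ?thesis .
qed

lemma has_bochner_integral_gauss_mono_0:
  "has_bochner_integral lborel (gauss_mono 0 0 i j) (of_real (gauss_moment i * gauss_moment j))"
  using has_bochner_integral_of_real[OF has_bochner_integral_complex_gauss[of i j]]
  by (simp add: gauss_mono_def[abs_def] scaleR_conv_of_real)

lemma integrable_gauss_mono: "integrable lborel (gauss_mono a b i j)"
proof (induction a arbitrary: i j)
  case 0
  show ?case
  proof (induction b arbitrary: i j)
    case 0
    then show ?case using has_bochner_integral_gauss_mono_0 by (rule integrable.intros)
  next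
    case (Suc b)
    then show ?case by (simp add: gauss_mono_Suc_2[abs_def])
  qed
next
  case (Suc a)
  then show ?case by (simp add: gauss_mono_Suc_1[abs_def])
qed

definition gauss_mono_int :: "nat \<Rightarrow> nat \<Rightarrow> nat \<Rightarrow> nat \<Rightarrow> complex" where
  "gauss_mono_int a b i j = integral\<^sup>L lborel (gauss_mono a b i j)"

lemma gauss_mono_int_Suc_1:
  "gauss_mono_int (Suc a) b i j = gauss_mono_int a b (Suc i) j + \<i> * gauss_mono_int a b i (Suc j)"
  by (simp add: gauss_mono_int_def gauss_mono_Suc_1[abs_def] integrable_gauss_mono)

lemma gauss_mono_int_Suc_2:
  "gauss_mono_int a (Suc b) i j = gauss_mono_int a b (Suc i) j - \<i> * gauss_mono_int a b i (Suc j)"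
  by (simp add: gauss_mono_int_def gauss_mono_Suc_2[abs_def] integrable_gauss_mono)

lemma gauss_mono_int_0: "gauss_mono_int 0 0 i j = of_real (gauss_moment i * gauss_moment j)"
  unfolding gauss_mono_int_def
  by (rule has_bochner_integral_integral_eq[OF has_bochner_integral_gauss_mono_0])

text \<open>The identities say that the partial derivatives of the integrand in \<open>Re z\<close>
  and \<open>Im z\<close> integrate to zero. The induction trades each factor \<open>z\<close> or
  \<open>cnj z\<close> for higher \<open>i\<close>, \<open>j\<close>, down to one-dimensional
  moments; as this mixes the variables, both identities are proved at once.\<close>

lemma gauss_mono_int_by_parts:
  "2 * gauss_mono_int a b (Suc i) j = of_nat a * gauss_mono_int (a - 1) b i j
     + of_nat b * gauss_mono_int a (b - 1) i j + of_nat i * gauss_mono_int a b (i - 1) j \<and>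
   2 * gauss_mono_int a b i (Suc j) = \<i> * (of_nat a * gauss_mono_int (a - 1) b i j)
     - \<i> * (of_nat b * gauss_mono_int a (b - 1) i j) + of_nat j * gauss_mono_int a b i (j - 1)"
proof (induction a arbitrary: i j)
  case 0
  show ?case
  proof (induction b arbitrary: i j)
    case 0
    have "2 * gauss_mono_int 0 0 (Suc i) j = of_real ((2 * gauss_moment (Suc i)) * gauss_moment j)"
      "2 * gauss_mono_int 0 0 i (Suc j) = of_real (gauss_moment i * (2 * gauss_moment (Suc j)))"
      by (simp_all add: gauss_mono_int_0)
    then show ?case
      unfolding gauss_moment_Suc by (simp add: gauss_mono_int_0)
  next
    case (Suc b)
    show ?case
    proof
      have "2 * gauss_mono_int 0 (Suc b) (Suc i) j =
          2 * gauss_mono_int 0 b (Suc (Suc i)) j - \<i> * (2 * gauss_mono_int 0 b (Suc i) (Suc j))"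
        by (simp add: gauss_mono_int_Suc_2 algebra_simps)
      then show "2 * gauss_mono_int 0 (Suc b) (Suc i) j =
          of_nat 0 * gauss_mono_int (0 - 1) (Suc b) i j
          + of_nat (Suc b) * gauss_mono_int 0 (Suc b - 1) i j
          + of_nat i * gauss_mono_int 0 (Suc b) (i - 1) j"
        unfolding Suc[THEN conjunct1] Suc[THEN conjunct2, of "Suc i"]
        by (cases b; cases i) (simp_all add: gauss_mono_int_Suc_2 algebra_simps)
      have "2 * gauss_mono_int 0 (Suc b) i (Suc j) =
          2 * gauss_mono_int 0 b (Suc i) (Suc j) - \<i> * (2 * gauss_mono_int 0 b i (Suc (Suc j)))"
        by (simp add: gauss_mono_int_Suc_2 algebra_simps)
      then show "2 * gauss_mono_int 0 (Suc b) i (Suc j) =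
          \<i> * (of_nat 0 * gauss_mono_int (0 - 1) (Suc b) i j)
          - \<i> * (of_nat (Suc b) * gauss_mono_int 0 (Suc b - 1) i j)
          + of_nat j * gauss_mono_int 0 (Suc b) i (j - 1)"
        unfolding Suc[THEN conjunct1] Suc[THEN conjunct2]
        by (cases b; cases j) (simp_all add: gauss_mono_int_Suc_2 algebra_simps)
    qed
  qed
next
  case (Suc a)
  show ?case
  proof
    have "2 * gauss_mono_int (Suc a) b (Suc i) j =
        2 * gauss_mono_int a b (Suc (Suc i)) j + \<i> * (2 * gauss_mono_int a b (Suc i) (Suc j))"
      by (simp add: gauss_mono_int_Suc_1 algebra_simps)
    then show "2 * gauss_mono_int (Suc a) b (Suc i) j =
        of_nat (Suc a) * gauss_mono_int (Suc a - 1) b i j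
        + of_nat b * gauss_mono_int (Suc a) (b - 1) i j
        + of_nat i * gauss_mono_int (Suc a) b (i - 1) j"
      unfolding Suc[THEN conjunct1] Suc[THEN conjunct2, of "Suc i"]
      by (cases a; cases i) (simp_all add: gauss_mono_int_Suc_1 algebra_simps)
    have "2 * gauss_mono_int (Suc a) b i (Suc j) =
        2 * gauss_mono_int a b (Suc i) (Suc j) + \<i> * (2 * gauss_mono_int a b i (Suc (Suc j)))"
      by (simp add: gauss_mono_int_Suc_1 algebra_simps)
    then show "2 * gauss_mono_int (Suc a) b i (Suc j) =
        \<i> * (of_nat (Suc a) * gauss_mono_int (Suc a - 1) b i j)
        - \<i> * (of_nat b * gauss_mono_int (Suc a) (b - 1) i j)
        + of_nat j * gauss_mono_int (Suc a) b i (j - 1)"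
      unfolding Suc[THEN conjunct1] Suc[THEN conjunct2]
      by (cases a; cases j) (simp_all add: gauss_mono_int_Suc_1 algebra_simps)
  qed
qed

text \<open>Adding \<open>\<i>\<close> times the second integration by parts to the first cancels
  the terms in \<open>a\<close>, so passing from \<open>Suc a\<close>, \<open>b\<close> to
  \<open>a\<close>, \<open>b - 1\<close> costs the factor \<open>b\<close>.\<close>

lemma gauss_mono_int_eq: "gauss_mono_int a b 0 0 = (if a = b then of_real (pi * fact a) else 0)"
proof (induction a arbitrary: b)
  case 0
  show ?case
  proof (cases b)
    case 0
    then show ?thesis by (simp add: gauss_mono_int_0 gauss_moment_0 flip: of_real_mult)
  next
    case (Suc c)
    have "2 * gauss_mono_int 0 b 0 0 =
        2 * gauss_mono_int 0 c (Suc 0) 0 - \<i> * (2 * gauss_mono_int 0 c 0 (Suc 0))"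
      by (simp add: Suc gauss_mono_int_Suc_2)
    also have "\<dots> = 0"
      unfolding gauss_mono_int_by_parts[THEN conjunct1] gauss_mono_int_by_parts[THEN conjunct2] by simp
    finally show ?thesis using Suc by simp
  qed
next
  case (Suc a)
  have "2 * gauss_mono_int (Suc a) b 0 0 =
      2 * gauss_mono_int a b (Suc 0) 0 + \<i> * (2 * gauss_mono_int a b 0 (Suc 0))"
    by (simp add: gauss_mono_int_Suc_1)
  also have "\<dots> = 2 * (of_nat b * gauss_mono_int a (b - 1) 0 0)"
    unfolding gauss_mono_int_by_parts[THEN conjunct1] gauss_mono_int_by_parts[THEN conjunct2]
    by (simp add: algebra_simps)
  finally show ?case
    by (cases b) (simp_all add: Suc.IH)
qed

section \<open>Gaussian norm of the complex Hermite polynomials\<close>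

definition gauss_int :: "(complex \<Rightarrow> complex) \<Rightarrow> complex" where
  "gauss_int f = (LINT z|lborel. exp (- (norm z)\<^sup>2) *\<^sub>R f z)"

definition gauss_integrable :: "(complex \<Rightarrow> complex) \<Rightarrow> bool" where
  "gauss_integrable f \<longleftrightarrow> integrable lborel (\<lambda>z. exp (- (norm z)\<^sup>2) *\<^sub>R f z)"

lemma gauss_int_monomial: "gauss_int (\<lambda>z. z ^ a * cnj z ^ b) = (if a = b then of_real (pi * fact a) else 0)"
  using gauss_mono_int_eq[of a b] by (simp add: gauss_int_def gauss_mono_int_def gauss_mono_def[abs_def])

lemma gauss_integrable_monomial: "gauss_integrable (\<lambda>z. z ^ a * cnj z ^ b)"
  using integrable_gauss_mono[of a b 0 0] by (simp add: gauss_integrable_def gauss_mono_def[abs_def])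

lemma gauss_integrable_scaleR: "gauss_integrable f \<Longrightarrow> gauss_integrable (\<lambda>z. c *\<^sub>R f z)"
  unfolding gauss_integrable_def scaleR_left_commute[of _ c] by (rule integrable_scaleR_right)

lemma gauss_int_scaleR: "gauss_int (\<lambda>z. c *\<^sub>R f z) = c *\<^sub>R gauss_int f"
  unfolding gauss_int_def scaleR_left_commute[of _ c] by (rule integral_scaleR_right)

lemma gauss_integrable_diff:
  "gauss_integrable f \<Longrightarrow> gauss_integrable g \<Longrightarrow> gauss_integrable (\<lambda>z. f z - g z)"
  by (simp add: gauss_integrable_def scaleR_diff_right)

lemma gauss_int_diff:
  "gauss_integrable f \<Longrightarrow> gauss_integrable g \<Longrightarrow> gauss_int (\<lambda>z. f z - g z) = gauss_int f - gauss_int g"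
  by (simp add: gauss_int_def gauss_integrable_def scaleR_diff_right)

lemma gauss_integrable_sum:
  "(\<And>i. i \<in> A \<Longrightarrow> gauss_integrable (f i)) \<Longrightarrow> gauss_integrable (\<lambda>z. \<Sum>i\<in>A. f i z)"
  by (simp add: gauss_integrable_def scaleR_sum_right)

lemma gauss_int_sum:
  "(\<And>i. i \<in> A \<Longrightarrow> gauss_integrable (f i)) \<Longrightarrow>
    gauss_int (\<lambda>z. \<Sum>i\<in>A. f i z) = (\<Sum>i\<in>A. gauss_int (f i))"
  by (simp add: gauss_int_def gauss_integrable_def scaleR_sum_right)

text \<open>\<open>hermite2_Suc\<close> lowers \<open>n\<close> at the price of one more
  \<open>cnj z\<close> or a smaller \<open>m\<close>, hence the induction with \<open>m\<close> and
  \<open>a\<close> arbitrary. The factor \<open>b choose n\<close> encodes orthogonality: it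
  vanishes for \<open>b < n\<close>.\<close>

lemma gauss_int_hermite2_monomial:
  "gauss_integrable (\<lambda>z. hermite2 m n z (cnj z) * (z ^ b * cnj z ^ a)) \<and>
   gauss_int (\<lambda>z. hermite2 m n z (cnj z) * (z ^ b * cnj z ^ a)) =
     (if m + b = a + n then of_real (pi * (fact n * real (b choose n)) * fact a) else 0)"
proof (induction n arbitrary: m a)
  case 0
  show ?case
    using gauss_integrable_monomial[of "m + b" a] gauss_int_monomial[of "m + b" a]
    by (simp add: power_add mult.assoc)
next
  case (Suc n)
  let ?f = "\<lambda>m a z. hermite2 m n z (cnj z) * (z ^ b * cnj z ^ a)"
  have eq: "hermite2 m (Suc n) z (cnj z) * (z ^ b * cnj z ^ a) =
      ?f m (Suc a) z - real m *\<^sub>R ?f (m - 1) a z" for z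
    by (simp add: hermite2_Suc algebra_simps scaleR_conv_of_real)
  have int: "gauss_integrable (?f m (Suc a))" "gauss_integrable (\<lambda>z. real m *\<^sub>R ?f (m - 1) a z)"
    using Suc[of m "Suc a"] gauss_integrable_scaleR[OF Suc[of "m - 1" a, THEN conjunct1]] by blast+
  have "gauss_int (\<lambda>z. hermite2 m (Suc n) z (cnj z) * (z ^ b * cnj z ^ a)) =
      gauss_int (?f m (Suc a)) - real m *\<^sub>R gauss_int (?f (m - 1) a)"
    unfolding eq gauss_int_diff[OF int] gauss_int_scaleR ..
  also have "\<dots> = (if m + b = a + Suc n
      then of_real (pi * (fact (Suc n) * real (b choose Suc n)) * fact a) else 0)"
  proof (cases "m + b = a + Suc n")
    case True
    \<comment> \<open>The two contributions add up to \<open>a + 1 - m\<close> times a common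
      factor; here \<open>a + 1 - m = b - n\<close>, and absorption produces the next binomial
      coefficient.\<close>
    have "real (Suc n) * real (b choose Suc n) = (real b - real n) * real (b choose n)"
    proof (cases "n \<le> b")
      case True
      have "real (Suc n * (b choose Suc n)) = real ((b - n) * (b choose n))"
        by (simp only: binomial_absorption binomial_absorb_comp)
      then show ?thesis using True by (simp only: of_nat_mult of_nat_diff)
    qed (simp add: binomial_eq_0)
    also have "real b - real n = real (Suc a) - real m"
      using True by linarith
    finally have "real (Suc n) * real (b choose Suc n) = (real (Suc a) - real m) * real (b choose n)" .
    from arg_cong[OF this, of "\<lambda>r. fact n * r"] have *: "fact (Suc n) * real (b choose Suc n) =
        (real (Suc a) - real m) * (fact n * real (b choose n))"
      by (simp add: algebra_simps)
    have "gauss_int (?f m (Suc a)) = of_real (pi * (fact n * real (b choose n)) * fact (Suc a))"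
      using True Suc[of m "Suc a", THEN conjunct2] by (simp del: power_Suc fact_Suc)
    moreover have "real m *\<^sub>R gauss_int (?f (m - 1) a) =
        of_real (real m * (pi * (fact n * real (b choose n)) * fact a))"
      using True Suc by (cases m) (simp_all add: scaleR_conv_of_real)
    ultimately show ?thesis
      using True unfolding * by (simp add: algebra_simps)
  next
    case False
    then show ?thesis
      using Suc[of m "Suc a", THEN conjunct2] Suc[of "m - 1" a, THEN conjunct2]
      by (cases m) (simp_all del: power_Suc)
  qed
  finally show ?case
    unfolding eq using gauss_integrable_diff[OF int] by blast
qed

text \<open>Only the conjugated factor is expanded. Its \<open>i\<close>-th monomial contributes the
  factor \<open>(n - i) choose n\<close>, which is zero unless \<open>i = 0\<close>.\<close>

lemma gauss_int_hermite2_square: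
  "gauss_integrable (\<lambda>z. of_real ((norm (hermite2 m n z (cnj z)))\<^sup>2)) \<and>
   gauss_int (\<lambda>z. of_real ((norm (hermite2 m n z (cnj z)))\<^sup>2)) = of_real (pi * fact m * fact n)"
proof -
  define c where "c i = (-1) ^ i * fact i * real (m choose i) * real (n choose i)" for i
  let ?g = "\<lambda>i z. c i *\<^sub>R (hermite2 m n z (cnj z) * (z ^ (n - i) * cnj z ^ (m - i)))"
  have eq: "of_real ((norm (hermite2 m n z (cnj z)))\<^sup>2) = (\<Sum>i\<le>min m n. ?g i z)" for z :: complex
  proof -
    have "cnj (hermite2 m n z (cnj z)) = (\<Sum>i\<le>min m n. c i *\<^sub>R (cnj z ^ (m - i) * z ^ (n - i)))"
      by (simp add: hermite2_atMost[of m n "min m n"] c_def)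
    then have "hermite2 m n z (cnj z) * cnj (hermite2 m n z (cnj z)) = (\<Sum>i\<le>min m n. ?g i z)"
      by (simp add: sum_distrib_left mult.commute)
    then show ?thesis by (simp only: complex_norm_square)
  qed
  have int: "gauss_integrable (?g i)" for i
    using gauss_int_hermite2_monomial by (intro gauss_integrable_scaleR) blast
  have "gauss_int (?g i) = (if i = 0 then of_real (pi * fact m * fact n) else 0)"
    if "i \<in> {..min m n}" for i
    unfolding gauss_int_scaleR using that gauss_int_hermite2_monomial[of m n "n - i" "m - i"]
    by (auto simp: c_def binomial_eq_0)
  then have "(\<Sum>i\<le>min m n. gauss_int (?g i)) = of_real (pi * fact m * fact n)"
    by simp
  then show ?thesis
    unfolding eq using gauss_int_sum[of "{..min m n}" ?g, OF int] gauss_integrable_sum[of "{..min m n}" ?g, OF int]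
    by simp
qed

lemma integral_hermite2_square:
  "(LINT z|lborel. (norm (hermite2 m n z (cnj z)))\<^sup>2 * exp (- (norm z)\<^sup>2)) = pi * fact m * fact n"
proof -
  have "complex_of_real (LINT z|lborel. (norm (hermite2 m n z (cnj z)))\<^sup>2 * exp (- (norm z)\<^sup>2)) =
      gauss_int (\<lambda>z. of_real ((norm (hermite2 m n z (cnj z)))\<^sup>2))"
    unfolding gauss_int_def integral_complex_of_real[symmetric]
    by (rule Bochner_Integration.integral_cong) (simp_all add: scaleR_conv_of_real mult.commute)
  also have "\<dots> = of_real (pi * fact m * fact n)"
    using gauss_int_hermite2_square by blast
  finally show ?thesis by (simp only: of_real_eq_iff)
qed

section \<open>The kernel\<close>

lemma imag_unit_iff:
  "imag_unit I \<longleftrightarrow> qRe I = 0 \<and> qIm1 I * qIm1 I + qIm2 I * qIm2 I + qIm3 I * qIm3 I = 1"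
proof
  assume "imag_unit I"
  then have I: "qRe I * qRe I - qIm1 I * qIm1 I - qIm2 I * qIm2 I - qIm3 I * qIm3 I = -1"
    "qRe I * qIm1 I = 0" "qRe I * qIm2 I = 0" "qRe I * qIm3 I = 0"
    by (simp_all add: imag_unit_def power2_eq_square quat_eq_iff algebra_simps)
  have "qRe I = 0"
  proof (rule ccontr)
    assume "qRe I \<noteq> 0"
    then have "qRe I * qRe I = -1" using I by simp
    then show False using zero_le_square[of "qRe I"] by linarith
  qed
  then show "qRe I = 0 \<and> qIm1 I * qIm1 I + qIm2 I * qIm2 I + qIm3 I * qIm3 I = 1"
    using I by simp
qed (simp add: imag_unit_def power2_eq_square quat_eq_iff algebra_simps)

lemma slice_embed_simps:
  assumes "imag_unit I"
  shows "qRe (slice_embed I z) = Re z" "qIm1 (slice_embed I z) = Im z * qIm1 I"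
    "qIm2 (slice_embed I z) = Im z * qIm2 I" "qIm3 (slice_embed I z) = Im z * qIm3 I"
  using assms by (simp_all add: slice_embed_def imag_unit_iff of_real_def)

text \<open>Imaginary parts within one slice are parallel, so the cross product in the quaternion
  product vanishes.\<close>

lemma slice_embed_mult:
  assumes "imag_unit I"
  shows "slice_embed I (z * w) = slice_embed I z * slice_embed I w"
proof -
  have I: "qIm1 I * qIm1 I + qIm2 I * qIm2 I + qIm3 I * qIm3 I = 1"
    using assms by (simp only: imag_unit_iff)
  have "Im z * qIm1 I * (Im w * qIm1 I) + Im z * qIm2 I * (Im w * qIm2 I) + Im z * qIm3 I * (Im w * qIm3 I)
      = Im z * Im w * (qIm1 I * qIm1 I + qIm2 I * qIm2 I + qIm3 I * qIm3 I)"
    by (simp add: algebra_simps)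
  then have "Im z * qIm1 I * (Im w * qIm1 I) + Im z * qIm2 I * (Im w * qIm2 I)
      + Im z * qIm3 I * (Im w * qIm3 I) = Im z * Im w"
    by (simp only: I mult_1_right)
  then show ?thesis
    by (simp add: quat_eq_iff slice_embed_simps[OF assms] algebra_simps)
qed

lemma norm_slice_embed:
  assumes "imag_unit I"
  shows "norm (slice_embed I z) = norm z"
proof -
  have "(norm (slice_embed I z))\<^sup>2 = (Re z)\<^sup>2 + (Im z)\<^sup>2 * (qIm1 I * qIm1 I + qIm2 I * qIm2 I + qIm3 I * qIm3 I)"
    unfolding norm_quat_power2 slice_embed_simps[OF assms]
    by (simp add: algebra_simps power2_eq_square)
  also have "\<dots> = (norm z)\<^sup>2"
    using assms by (simp add: imag_unit_iff cmod_power2)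
  finally show ?thesis by (simp add: power2_eq_iff_nonneg)
qed

lemma slice_embed_power:
  assumes "imag_unit I"
  shows "slice_embed I (z ^ n) = slice_embed I z ^ n"
  by (induction n) (simp_all add: slice_embed_mult[OF assms], simp add: slice_embed_def)

lemma bounded_linear_slice_embed:
  assumes "imag_unit I"
  shows "bounded_linear (slice_embed I)"
  by (rule bounded_linear_intro[of _ 1])
    (simp_all add: norm_slice_embed[OF assms], simp_all add: slice_embed_def algebra_simps scaleR_conv_of_real)

lemma slice_embed_hermite2:
  assumes "imag_unit I"
  shows "slice_embed I (hermite2 m n z w) = hermite2 m n (slice_embed I z) (slice_embed I w)"
proof -
  interpret bounded_linear "slice_embed I" by (rule bounded_linear_slice_embed[OF assms])
  show ?thesis
    by (simp add: hermite2_def sum scaleR slice_embed_mult[OF assms] slice_embed_power[OF assms])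
qed

lemma hermite_quat_slice_embed:
  assumes "imag_unit I"
  shows "hermite_quat m n (slice_embed I z) = slice_embed I (hermite2 m n z (cnj z))"
proof -
  have "qcnj (slice_embed I z) = slice_embed I (cnj z)"
    by (simp add: quat_eq_iff slice_embed_simps[OF assms])
  then show ?thesis
    by (simp add: hermite_quat_eq slice_embed_hermite2[OF assms])
qed

text \<open>\<open>slice_embed I\<close> is an isometric algebra embedding taking \<open>cnj\<close>
  to \<open>qcnj\<close>, so the integral pulls back to the complex one; the indicator of the slice
  becomes 1.\<close>

lemma slice_norm_hermite_quat:
  assumes I: "imag_unit I"
  shows "slice_norm I (hermite_quat m n) = sqrt (pi * fact m * fact n)"
proof -
  interpret bounded_linear "slice_embed I" by (rule bounded_linear_slice_embed[OF I])
  have "continuous_on UNIV (slice_embed I)"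
    by (simp add: linear_continuous_on bounded_linear_slice_embed[OF I])
  then have [measurable]: "slice_embed I \<in> borel_measurable borel"
    by (rule borel_measurable_continuous_onI)
  have "closed (slice I)"
    unfolding slice_def by (intro closed_subspace linear_subspace_image subspace_UNIV linear_axioms)
  then have [measurable]: "slice I \<in> sets borel" by (rule borel_closed)
  have "continuous_on UNIV (hermite_quat m n)"
    unfolding hermite_quat_def[abs_def]
    by (intro continuous_intros linear_continuous_on bounded_linear_qcnj)
  then have [measurable]: "hermite_quat m n \<in> borel_measurable borel"
    by (rule borel_measurable_continuous_onI)
  have "(LINT q:slice I|slice_lebesgue I. (norm (hermite_quat m n q))\<^sup>2 * exp (- (norm q)\<^sup>2)) =
      (LINT z|lborel. indicator (slice I) (slice_embed I z) *\<^sub>R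
        ((norm (hermite_quat m n (slice_embed I z)))\<^sup>2 * exp (- (norm (slice_embed I z))\<^sup>2)))"
    unfolding set_lebesgue_integral_def slice_lebesgue_def by (intro integral_distr) measurable
  also have "\<dots> = (LINT z|lborel. (norm (hermite2 m n z (cnj z)))\<^sup>2 * exp (- (norm z)\<^sup>2))"
    by (simp add: slice_def hermite_quat_slice_embed[OF I] norm_slice_embed[OF I])
  finally show ?thesis
    by (simp add: slice_norm_def integral_hermite2_square)
qed

lemma L2_norm_hermite_fun: "L2_norm (\<lambda>s. of_real (hermite_fun j s)) = sqrt (2 ^ j * fact j * sqrt pi)"
proof -
  have eq: "(norm (of_real (hermite_fun j s) :: quat))\<^sup>2 = exp (- s\<^sup>2) * (poly (hermite j) s)\<^sup>2" for s
    unfolding norm_of_real hermite_fun_eq by (simp add: power_mult_distrib flip: exp_double)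
  have "(\<lambda>s. of_real (hermite_fun j s)) \<in> L2_quat"
    unfolding L2_quat_def
  proof (intro CollectI IntI conjI)
    have "continuous_on UNIV (\<lambda>s. of_real (hermite_fun j s) :: quat)"
      unfolding hermite_fun_eq[abs_def] by (intro continuous_intros) auto
    then show "(\<lambda>s. of_real (hermite_fun j s) :: quat) \<in> borel_measurable lborel"
      by (simp add: borel_measurable_continuous_onI)
    show "integrable lborel (\<lambda>s. (norm (of_real (hermite_fun j s) :: quat))\<^sup>2)"
      unfolding eq by (rule integrable.intros[OF has_bochner_integral_hermite_square])
  qed
  from L2_norm_eq[OF this] show ?thesis
    unfolding eq has_bochner_integral_integral_eq[OF has_bochner_integral_hermite_square] .
qed

section \<open>The quaternionic exponential\<close>

lemma qcnj_exp: "qcnj (exp x) = exp (qcnj x)"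
proof -
  interpret bounded_linear qcnj by (rule bounded_linear_qcnj)
  have "(\<lambda>n. qcnj (x ^ n /\<^sub>R fact n)) sums qcnj (exp x)"
    by (intro sums exp_converges)
  then have "(\<lambda>n. qcnj x ^ n /\<^sub>R fact n) sums qcnj (exp x)"
    by (simp add: scaleR qcnj_power)
  then show ?thesis
    using exp_converges sums_unique2 by blast
qed

text \<open>\<open>x\<close> and \<open>qcnj x\<close> commute and have a real sum, so
  \<open>exp (qcnj x) * exp x\<close> collapses to a real exponential.\<close>

lemma norm_exp_quat: "norm (exp x) = exp (qRe x)" for x :: quat
proof -
  have add: "qcnj x + x = of_real (2 * qRe x)"
    by (simp add: quat_eq_iff of_real_def)
  have comm: "qcnj x * x = x * qcnj x"
    by (simp add: quat_eq_iff)
  have "of_real ((norm (exp x))\<^sup>2) = exp (qcnj x) * exp x"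
    by (simp only: qcnj_mult_self[symmetric] qcnj_exp)
  also have "\<dots> = exp (of_real (2 * qRe x))"
    by (simp only: exp_add_commuting[OF comm, symmetric] add)
  also have "\<dots> = of_real ((exp (qRe x))\<^sup>2)"
    by (simp only: exp_of_real exp_double)
  finally show ?thesis
    by (simp only: of_real_eq_iff power2_eq_iff_nonneg norm_ge_zero exp_ge_zero)
qed

section \<open>The closed form and its norm\<close>

definition kernel_closed :: "nat \<Rightarrow> real \<Rightarrow> quat \<Rightarrow> quat" where
  "kernel_closed k t q = ((1 / pi) powr (3 / 4) * (1 / sqrt (2 ^ k * fact k))) *\<^sub>R
     (exp (- ((of_real (t\<^sup>2) + (qcnj q)\<^sup>2) /\<^sub>R 2) + (sqrt 2 * t) *\<^sub>R qcnj q) *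
      real_poly_eval (hermite k) ((q + qcnj q) /\<^sub>R sqrt 2 - of_real t))"

lemma real_poly_eval_kernel:
  "real_poly_eval p ((q + qcnj q) /\<^sub>R sqrt 2 - of_real t) =
     of_real (poly p (2 * qRe q / sqrt 2 - t))"
proof -
  have "(q + qcnj q) /\<^sub>R sqrt 2 - of_real t = of_real (2 * qRe q / sqrt 2 - t)"
    by (simp add: quat_eq_iff of_real_def divide_inverse)
  then show ?thesis by (simp only: real_poly_eval_of_real)
qed

text \<open>The real summand \<open>- t^2 / 2\<close> is central and splits off, leaving the
  exponent of \<open>hermite2_generating_function\<close>.\<close>

lemma exp_kernel:
  fixes w :: "'a :: {real_normed_algebra_1, banach}"
  shows "exp (- ((of_real (t\<^sup>2) + w\<^sup>2) /\<^sub>R 2) + (sqrt 2 * t) *\<^sub>R w) =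
    exp (- t\<^sup>2 / 2) *\<^sub>R exp ((sqrt 2 * t) *\<^sub>R w - w\<^sup>2 /\<^sub>R 2)"
proof -
  let ?u = "(sqrt 2 * t) *\<^sub>R w - w\<^sup>2 /\<^sub>R 2"
  have "- ((of_real (t\<^sup>2) + w\<^sup>2) /\<^sub>R 2) + (sqrt 2 * t) *\<^sub>R w = of_real (- t\<^sup>2 / 2) + ?u"
    by (simp add: of_real_def scaleR_add_right)
  also have "exp \<dots> = exp (of_real (- t\<^sup>2 / 2)) * exp ?u"
    by (rule exp_add_commuting) (simp only: of_real_def scaleR_one mult_scaleR_left mult_scaleR_right mult_1 mult_1_right)
  also have "\<dots> = exp (- t\<^sup>2 / 2) *\<^sub>R exp ?u"
    by (simp only: exp_of_real scaleR_conv_of_real)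
  finally show ?thesis .
qed

text \<open>\<open>fact j\<close> stands under both roots and comes out whole, so the denominator of
  \<open>kernel_term\<close> matches the coefficients of
  \<open>hermite2_generating_function\<close>.\<close>

lemma hermite_norms_mult:
  "sqrt (2 ^ j * fact j * sqrt pi) * sqrt (pi * fact j * fact k) =
     sqrt 2 ^ j * fact j * sqrt (fact k) * pi powr (3 / 4)"
proof (rule power2_eq_imp_eq)
  have "(pi powr (3 / 4))\<^sup>2 = pi powr (1 + 1 / 2)"
    by (simp add: power2_eq_square flip: powr_add)
  also have "\<dots> = pi * sqrt pi"
    by (subst powr_add) (simp add: powr_half_sqrt)
  finally have "(pi powr (3 / 4))\<^sup>2 = pi * sqrt pi" .
  moreover have "(sqrt 2 ^ j)\<^sup>2 = 2 ^ j"
    by (simp add: power2_eq_square flip: power_mult_distrib)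
  ultimately show "(sqrt (2 ^ j * fact j * sqrt pi) * sqrt (pi * fact j * fact k))\<^sup>2 =
      (sqrt 2 ^ j * fact j * sqrt (fact k) * pi powr (3 / 4))\<^sup>2"
    by (simp add: power_mult_distrib) (simp add: power2_eq_square)
qed auto

lemma kernel_term_sums:
  assumes "imag_unit I"
  shows "kernel_term I k t q sums kernel_closed k t q"
proof -
  \<comment> \<open>\<open>A\<close> gathers the scalar factors independent of
    \<open>j\<close>.\<close>
  define A where "A = 1 / (sqrt (fact k) * pi powr (3 / 4)) * exp (- t\<^sup>2 / 2)"
  let ?P = "poly (hermite k) (2 * qRe q / sqrt 2 - t)"
  let ?E = "exp ((sqrt 2 * t) *\<^sub>R qcnj q - (qcnj q)\<^sup>2 /\<^sub>R 2)"
  have eq: "kernel_term I k t q j =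
      A *\<^sub>R ((poly (hermite j) t / (sqrt 2 ^ j * fact j)) *\<^sub>R hermite2 k j q (qcnj q))" for j
    unfolding kernel_term_def L2_norm_hermite_fun slice_norm_hermite_quat[OF assms] hermite_norms_mult
      hermite_quat_eq qcnj_hermite2 qcnj_qcnj
    unfolding hermite_fun_eq A_def by (simp add: field_simps)
  have "q + qcnj q = of_real (2 * qRe q)"
    by (simp add: quat_eq_iff of_real_def)
  from sums_scaleR_right[OF hermite2_generating_function[OF this], of A t k]
  have "kernel_term I k t q sums (A *\<^sub>R ((?P / sqrt 2 ^ k) *\<^sub>R ?E))"
    by (simp only: eq[abs_def])
  also have "A *\<^sub>R ((?P / sqrt 2 ^ k) *\<^sub>R ?E) = kernel_closed k t q"
  proof -
    let ?C = "(1 / pi) powr (3 / 4) * (1 / sqrt (2 ^ k * fact k))"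
    have "A * (?P / sqrt 2 ^ k) = ?C * exp (- t\<^sup>2 / 2) * ?P"
      by (simp add: A_def real_sqrt_mult real_sqrt_power powr_divide)
    then have "A *\<^sub>R ((?P / sqrt 2 ^ k) *\<^sub>R ?E) = (?C * exp (- t\<^sup>2 / 2) * ?P) *\<^sub>R ?E"
      by (simp only: scaleR_scaleR)
    also have "\<dots> = kernel_closed k t q"
      unfolding kernel_closed_def exp_kernel real_poly_eval_kernel by (simp add: of_real_def mult_ac)
    finally show ?thesis .
  qed
  finally show ?thesis .
qed

text \<open>The Hermite factor is real, and the modulus of the exponential depends only on the real
  part of its exponent, where the square in \<open>t\<close> is completed around
  \<open>sqrt 2 * qRe q\<close>.\<close>

lemma norm_kernel_closed:
  "(norm (kernel_closed k t q))\<^sup>2 = exp ((norm q)\<^sup>2) / (pi * sqrt pi * 2 ^ k * fact k) *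
     (exp (- (sqrt 2 * qRe q - t)\<^sup>2) * (poly (hermite k) (sqrt 2 * qRe q - t))\<^sup>2)"
proof -
  let ?x = "- ((of_real (t\<^sup>2) + (qcnj q)\<^sup>2) /\<^sub>R 2) + (sqrt 2 * t) *\<^sub>R qcnj q"
  have y: "2 * qRe q / sqrt 2 = sqrt 2 * qRe q"
    by (simp add: field_simps)
  have powr: "((1 / pi) powr (3 / 4))\<^sup>2 = 1 / (pi * sqrt pi)"
    using hermite_norms_mult[of 0 0] by (simp add: powr_divide power_divide real_sqrt_mult power_mult_distrib flip: hermite_norms_mult[of 0 0, simplified])
  have sq: "sqrt 2 * sqrt 2 = 2" by simp
  have "2 * qRe ?x = (norm q)\<^sup>2 - (sqrt 2 * qRe q - t)\<^sup>2"
    unfolding norm_quat_power2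
    by (simp add: power2_eq_square of_real_def algebra_simps)
  then have "(norm (exp ?x))\<^sup>2 = exp ((norm q)\<^sup>2) * exp (- (sqrt 2 * qRe q - t)\<^sup>2)"
    by (simp add: norm_exp_quat flip: exp_double exp_add)
  then show ?thesis
    unfolding kernel_closed_def real_poly_eval_kernel y
    by (simp add: norm_mult power_mult_distrib powr power_divide)
qed

lemma kernel_closed_L2:
  "(\<lambda>t. kernel_closed k t q) \<in> L2_quat"
  "L2_norm (\<lambda>t. kernel_closed k t q) = 1 / sqrt pi * exp ((norm q)\<^sup>2 / 2)"
proof -
  define c where "c = exp ((norm q)\<^sup>2) / (pi * sqrt pi * 2 ^ k * fact k)"
  have "has_bochner_integral lborel (\<lambda>t. (norm (kernel_closed k t q))\<^sup>2)
      (c * (2 ^ k * fact k * sqrt pi))"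
    unfolding norm_kernel_closed c_def[symmetric]
    \<comment> \<open>Replacing \<open>t\<close> by \<open>sqrt 2 * qRe q - t\<close> has slope
      \<open>-1\<close>, so the integral of the Hermite square is unchanged.\<close>
    using lborel_has_bochner_integral_real_affine_iff[THEN iffD1,
        OF _ has_bochner_integral_hermite_square[of k], of "-1" "sqrt 2 * qRe q"]
    by (intro has_bochner_integral_mult_right) simp
  also have "c * (2 ^ k * fact k * sqrt pi) = exp ((norm q)\<^sup>2) / pi"
    by (simp add: c_def)
  finally have int: "has_bochner_integral lborel (\<lambda>t. (norm (kernel_closed k t q))\<^sup>2)
      (exp ((norm q)\<^sup>2) / pi)" .
  have "continuous_on UNIV (\<lambda>t. kernel_closed k t q)"
  proof -
    have cont: "continuous_on UNIV (\<lambda>t. exp (t *\<^sub>R a))" for a :: quat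
      by (auto intro!: continuous_at_imp_continuous_on has_vector_derivative_continuous
          exp_scaleR_has_vector_derivative_right)
    \<comment> \<open>Both exponents are built from \<open>w\<close> and commute; splitting them
      confines \<open>t\<close> to a one-parameter exponential, known to be differentiable.\<close>
    have fac: "exp ((sqrt 2 * t) *\<^sub>R w - w\<^sup>2 /\<^sub>R 2) =
        exp (t *\<^sub>R (sqrt 2 *\<^sub>R w)) * exp (- (w\<^sup>2 /\<^sub>R 2))" for t and w :: quat
      using exp_add_commuting[of "t *\<^sub>R (sqrt 2 *\<^sub>R w)" "- (w\<^sup>2 /\<^sub>R 2)"]
      by (simp add: power2_eq_square mult.assoc mult.commute)
    show ?thesis
      unfolding kernel_closed_def real_poly_eval_kernel exp_kernel fac
      by (intro continuous_intros cont) auto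
  qed
  then have "(\<lambda>t. kernel_closed k t q) \<in> borel_measurable lborel"
    by (simp add: borel_measurable_continuous_onI)
  then show L2: "(\<lambda>t. kernel_closed k t q) \<in> L2_quat"
    using integrable.intros[OF int] by (simp add: L2_quat_def)
  have "(exp ((norm q)\<^sup>2 / 2))\<^sup>2 = exp ((norm q)\<^sup>2)"
    by (simp flip: exp_double)
  then have "sqrt (exp ((norm q)\<^sup>2)) = exp ((norm q)\<^sup>2 / 2)"
    by (intro real_sqrt_unique) auto
  then show "L2_norm (\<lambda>t. kernel_closed k t q) = 1 / sqrt pi * exp ((norm q)\<^sup>2 / 2)"
    unfolding L2_norm_eq[OF L2] has_bochner_integral_integral_eq[OF int]
    by (simp add: real_sqrt_divide)
qed

theorem theorem4p1:
  fixes k :: nat and I :: quat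
  assumes "imag_unit I"
  shows "(\<forall>t q. summable (kernel_term I k t q) \<and>
            kernel_B2 I k t q =
              ((1 / pi) powr (3 / 4) * (1 / sqrt (2 ^ k * fact k))) *\<^sub>R
                (exp (- ((of_real (t\<^sup>2) + (qcnj q)\<^sup>2) /\<^sub>R 2) + (sqrt 2 * t) *\<^sub>R qcnj q) *
                 real_poly_eval (hermite k) ((q + qcnj q) /\<^sub>R sqrt 2 - of_real t))) \<and>
         (\<forall>q. (\<lambda>t. kernel_B2 I k t q) \<in> L2_quat \<and>
            L2_norm (\<lambda>t. kernel_B2 I k t q) = 1 / sqrt pi * exp ((norm q)\<^sup>2 / 2))"
proof -
  have sum: "summable (kernel_term I k t q)" and eq: "kernel_B2 I k t q = kernel_closed k t q" for t q
    using kernel_term_sums[OF assms, of k t q] by (simp_all add: kernel_B2_def sums_iff)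
  show ?thesis
    unfolding eq by (intro conjI allI sum kernel_closed_L2) (rule kernel_closed_def)
qed

end
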